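(* Let $\mathcal{I}=k[a,b]\cap H$, where $$H=\langle\, 1-w\,\tilde\gamma_1\cdots\tilde\gamma_\ell,\ \ a_{p_jq_j}-t_j,\ \ \tilde\gamma_j\,b_{q_jp_j}-\tilde{\tilde\gamma}_j\,t_j \ \mid\ j=1,\dots,\ell\,\rangle\subset k[a,b,t_1,\dots,t_\ell,\gamma,w],$$ and let $I_S\subset k[a,b]$ be the Sibirsky ideal. Then $I_S=\mathcal{I}$, and both ideals are prime.
   Context: Let $k$ be an infinite field, let $\mathbb{N}_0$ be the set of nonnegative integers, and fix a finite set of $\ell$ distinct pairs $S=\{(p_j,q_j)\mid p_j+q_j\ge 0,\ j=1,\dots,\ell\}\subset(\{-1\}\cup\mathbb{N}_0)\times\mathbb{N}_0$. Let $k[a,b]$ be the polynomial ring over $k$ in the $2\ell$ variables $a_{p_1q_1},\dots,a_{p_\ell q_\ell},b_{q_\ell p_\ell},\dots,b_{q_1p_1}$, and let $k[a,b,t_1,\dots,t_\ell,\gamma,w]$ be the polynomial ring obtained by adjoining further variables $t_1,\dots,t_\ell,\gamma,w$. For $j=1,\dots,\ell$: if $p_j-q_j\le0$, put $\tilde\gamma_j=\gamma^{q_j-p_j}$ and $\tilde{\tilde\gamma}_j=1$; if $p_j-q_j>0$, put $\tilde\gamma_j=1$ and $\tilde{\tilde\gamma}_j=\gamma^{p_j-q_j}$. The notation $\langle h_1,\dots,h_m\rangle$ denotes the ideal generated by $h_1,\dots,h_m$. Let $\zeta=(p_1-q_1,\dots,p_\ell-q_\ell,q_\ell-p_\ell,\dots,q_1-p_1)\in\mathbb{Z}^{2\ell}$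 and let $\mathcal{M}=\{\nu\in\mathbb{N}_0^{2\ell}\mid \zeta_1\nu_1+\cdots+\zeta_{2\ell}\nu_{2\ell}=0\}$. For $\nu=(\nu_1,\dots,\nu_{2\ell})\in\mathbb{N}_0^{2\ell}$ put $[\nu]=a_{p_1q_1}^{\nu_1}\cdots a_{p_\ell q_\ell}^{\nu_\ell}b_{q_\ell p_\ell}^{\nu_{\ell+1}}\cdots b_{q_1p_1}^{\nu_{2\ell}}$ and $\hat\nu=(\nu_{2\ell},\nu_{2\ell-1},\dots,\nu_1)$. The Sibirsky ideal is $I_S=\langle[\nu]-[\hat\nu]\mid\nu\in\mathcal{M}\rangle\subset k[a,b]$. *)

theory Defs
  imports "HOL-Algebra.Ideal" "HOL-Library.Poly_Mapping"
begin

type_synonym ('v, 'k) mpoly = "('v \<Rightarrow>\<^sub>0 nat) \<Rightarrow>\<^sub>0 'k"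

definition pvar :: "'v \<Rightarrow> ('v, 'k::comm_ring_1) mpoly" where
  "pvar v = Poly_Mapping.single (Poly_Mapping.single v 1) 1"

definition mpoly_ring :: "'v set \<Rightarrow> ('v, 'k::comm_ring_1) mpoly ring" where
  "mpoly_ring V =
     \<lparr>carrier = {f. \<forall>m \<in> Poly_Mapping.keys f. Poly_Mapping.keys m \<subseteq> V},
      mult = (*), one = 1, zero = 0, add = (+)\<rparr>"

lemma mpoly_ring_cring: "cring (mpoly_ring V :: ('v, 'k::comm_ring_1) mpoly ring)"
proof -
  define C where "C = {f :: ('v, 'k) mpoly. \<forall>m \<in> Poly_Mapping.keys f. Poly_Mapping.keys m \<subseteq> V}"
  have R: "mpoly_ring V = \<lparr>carrier = C, mult = (*), one = 1, zero = 0, add = (+)\<rparr>"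
    unfolding mpoly_ring_def C_def ..
  have zero: "0 \<in> C" and one: "1 \<in> C"
    by (simp_all add: C_def)
  have add: "f + g \<in> C" if "f \<in> C" "g \<in> C" for f g
    using that Poly_Mapping.keys_add[of f g] unfolding C_def mem_Collect_eq
    by (meson Un_iff subsetD)
  have mult: "f * g \<in> C" if fg: "f \<in> C" "g \<in> C" for f g
    unfolding C_def mem_Collect_eq
  proof
    fix m assume "m \<in> Poly_Mapping.keys (f * g)"
    then obtain a b where ab: "m = a + b" "a \<in> Poly_Mapping.keys f" "b \<in> Poly_Mapping.keys g"
      using keys_mult[of f g] by blast
    have "Poly_Mapping.keys a \<subseteq> V" "Poly_Mapping.keys b \<subseteq> V"
      using ab fg unfolding C_def mem_Collect_eq by metis+
    then show "Poly_Mapping.keys m \<subseteq> V"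
      using Poly_Mapping.keys_add[of a b] unfolding ab(1) by (meson Un_least order_trans)
  qed
  have uminus: "- f \<in> C" if "f \<in> C" for f
  proof -
    have "Poly_Mapping.keys (- f) = Poly_Mapping.keys f"
      by (auto simp: in_keys_iff)
    then show ?thesis
      using that unfolding C_def mem_Collect_eq by metis
  qed
  show ?thesis
    unfolding R
  proof (rule cringI)
    show "abelian_group \<lparr>carrier = C, mult = (*), one = 1, zero = 0, add = (+)\<rparr>"
    proof (rule abelian_groupI, goal_cases)
      case (6 f)
      then show ?case
        using uminus[of f] by (intro bexI[of _ "- f"]) simp_all
    qed (simp_all add: zero add add.assoc add.commute)
    show "comm_monoid \<lparr>carrier = C, mult = (*), one = 1, zero = 0, add = (+)\<rparr>"
      by (rule comm_monoidI) (simp_all add: one mult mult.assoc mult.commute)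
  qed (simp add: distrib_right)
qed

text \<open>
  The set \<open>S\<close> is given as a list of pairs \<open>(p, q)\<close>, which fixes its enumeration. Coefficient
  variables carry the actual subscripts, \<open>VarA p q\<close> for \<open>a\<^sub>p\<^sub>q\<close> and \<open>VarB q p\<close> for \<open>b\<^sub>q\<^sub>p\<close>, so
  distinctness of the pairs is what makes them \<open>2 * length S\<close> different variables.
  Positions in lists, and the index of \<open>t\<close>, start at 0.
\<close>

datatype sib_var = VarA int nat | VarB nat int | VarT nat | VarGamma | VarW

definition ab_list :: "(int \<times> nat) list \<Rightarrow> sib_var list" where
  "ab_list S = map (\<lambda>(p, q). VarA p q) S @ rev (map (\<lambda>(p, q). VarB q p) S)"

abbreviation ring_ab :: "(int \<times> nat) list \<Rightarrow> (sib_var, 'k::comm_ring_1) mpoly ring" where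
  "ring_ab S \<equiv> mpoly_ring (set (ab_list S))"

abbreviation ring_abtgw :: "(int \<times> nat) list \<Rightarrow> (sib_var, 'k::comm_ring_1) mpoly ring" where
  "ring_abtgw S \<equiv>
     mpoly_ring (set (ab_list S) \<union> VarT ` {..<length S} \<union> {VarGamma, VarW})"

definition gamma1 :: "int \<times> nat \<Rightarrow> (sib_var, 'k::comm_ring_1) mpoly" where
  "gamma1 = (\<lambda>(p, q). if p - int q \<le> 0 then pvar VarGamma ^ nat (int q - p) else 1)"

definition gamma2 :: "int \<times> nat \<Rightarrow> (sib_var, 'k::comm_ring_1) mpoly" where
  "gamma2 = (\<lambda>(p, q). if p - int q \<le> 0 then 1 else pvar VarGamma ^ nat (p - int q))"

definition ideal_H :: "(int \<times> nat) list \<Rightarrow> (sib_var, 'k::comm_ring_1) mpoly set" where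
  "ideal_H S = genideal (ring_abtgw S)
     ({1 - pvar VarW * (\<Prod>j<length S. gamma1 (S ! j))}
      \<union> {pvar (VarA p q) - pvar (VarT j) | j p q. j < length S \<and> S ! j = (p, q)}
      \<union> {gamma1 (p, q) * pvar (VarB q p) - gamma2 (p, q) * pvar (VarT j) | j p q.
           j < length S \<and> S ! j = (p, q)})"

definition elim_ideal :: "(int \<times> nat) list \<Rightarrow> (sib_var, 'k::comm_ring_1) mpoly set" where
  "elim_ideal S = carrier (ring_ab S) \<inter> ideal_H S"

definition zeta :: "(int \<times> nat) list \<Rightarrow> int list" where
  "zeta S = map (\<lambda>(p, q). p - int q) S @ rev (map (\<lambda>(p, q). int q - p) S)"

text \<open>Exponent vectors are lists of length \<open>2 * length S\<close>; the involution on them is \<open>rev\<close>.\<close>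

definition sib_monoid :: "(int \<times> nat) list \<Rightarrow> nat list set" where
  "sib_monoid S =
     {\<nu>. length \<nu> = 2 * length S \<and> (\<Sum>i<2 * length S. zeta S ! i * int (\<nu> ! i)) = 0}"

definition sib_monom :: "(int \<times> nat) list \<Rightarrow> nat list \<Rightarrow> (sib_var, 'k::comm_ring_1) mpoly" where
  "sib_monom S \<nu> = (\<Prod>i<2 * length S. pvar (ab_list S ! i) ^ (\<nu> ! i))"

definition sibirsky_ideal :: "(int \<times> nat) list \<Rightarrow> (sib_var, 'k::comm_ring_1) mpoly set" where
  "sibirsky_ideal S =
     genideal (ring_ab S) {sib_monom S \<nu> - sib_monom S (rev \<nu>) | \<nu>. \<nu> \<in> sib_monoid S}"

end

(*
  Both ideals are the kernel of the homomorphism from k[a,b] to the Laurent polynomials in the t_j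
  and gamma that sends a_pq to t_j and b_qp to gamma^(p-q) t_j; a kernel of a map into a domain is
  prime. The proof runs through a cycle of inclusions. Modulo H every gamma1 is invertible, and
  multiplying [nu] and its mirror image by the same product of gamma1's turns both into the same
  monomial in gamma and t, so the generators of I_S lie in H. The homomorphism extends to all
  variables (w goes to a negative power of gamma) and kills the generators of H. Finally, the
  kernel is spanned by differences of monomials with equal image, and such a difference is a
  monomial multiple of a generator of I_S.
*)
theory Submission
  imports Defs "HOL-Library.Countable"
begin

subsection \<open>Push-forward of polynomials along maps of exponents\<close>

text \<open>The linear extension of \<open>h\<close> to formal sums: coefficients of exponents with
  the same image add up.\<close>

definition push :: "('a \<Rightarrow> 'b) \<Rightarrow> ('a \<Rightarrow>\<^sub>0 'k::comm_monoid_add) \<Rightarrow> 'b \<Rightarrow>\<^sub>0 'k" where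
  "push h f = (\<Sum>m\<in>Poly_Mapping.keys f. Poly_Mapping.single (h m) (Poly_Mapping.lookup f m))"

lemma push_superset:
  assumes "finite A" "Poly_Mapping.keys f \<subseteq> A"
  shows "push h f = (\<Sum>m\<in>A. Poly_Mapping.single (h m) (Poly_Mapping.lookup f m))"
  unfolding push_def
  by (rule sum.mono_neutral_left) (use assms in \<open>auto simp: in_keys_iff\<close>)

lemma push_single [simp]: "push h (Poly_Mapping.single m c) = Poly_Mapping.single (h m) c"
  by (subst push_superset[of "{m}"]) auto

lemma push_0 [simp]: "push h 0 = 0"
  by (simp add: push_def)

lemma push_add: "push h (f + g) = push h f + push h g"
proof -
  let ?A = "Poly_Mapping.keys f \<union> Poly_Mapping.keys g"
  have "Poly_Mapping.keys (f + g) \<subseteq> ?A" by (rule Poly_Mapping.keys_add)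
  then show ?thesis
    by (simp add: push_superset[of ?A] lookup_add single_add sum.distrib)
qed

lemma push_uminus: "push h (- f) = - push h (f :: 'a \<Rightarrow>\<^sub>0 'k::ab_group_add)"
  using push_add[of h f "- f"] by (simp add: eq_neg_iff_add_eq_0 add.commute)

lemma push_diff: "push h (f - g) = push h f - push h (g :: 'a \<Rightarrow>\<^sub>0 'k::ab_group_add)"
  using push_add[of h f "- g"] by (simp add: push_uminus)

lemma push_sum: "push h (\<Sum>i\<in>I. f i) = (\<Sum>i\<in>I. push h (f i))"
  by (induction I rule: infinite_finite_induct) (simp_all add: push_add)

text \<open>Linearity of \<open>push g\<close> lets the sum run over the keys of \<open>f\<close>,
  so cancellation inside \<open>push h f\<close> never has to be tracked.\<close>

lemma push_push: "push g (push h f) = (\<Sum>m\<in>Poly_Mapping.keys f. Poly_Mapping.single (g (h m)) (Poly_Mapping.lookup f m))"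
  by (simp add: push_def[of h] push_sum)

lemma poly_mapping_expansion: "(\<Sum>m\<in>Poly_Mapping.keys f. Poly_Mapping.single m (Poly_Mapping.lookup f m)) = f"
  by (rule poly_mapping_eqI)
    (auto simp: lookup_sum lookup_single when_def in_keys_iff)

lemma poly_mapping_expansion_superset:
  assumes "finite A" "Poly_Mapping.keys f \<subseteq> A"
  shows "(\<Sum>m\<in>A. Poly_Mapping.single m (Poly_Mapping.lookup f m)) = f"
  using push_superset[OF assms, of "\<lambda>m. m"] poly_mapping_expansion[of f] by (simp add: push_def)

text \<open>For additive \<open>h\<close> the claim holds on monomials, and both sides are
  biadditive, so expanding \<open>f\<close> and \<open>g\<close> into monomials suffices.\<close>

lemma push_mult:
  fixes f g :: "'a::monoid_add \<Rightarrow>\<^sub>0 'k::comm_semiring_0" and h :: "'a \<Rightarrow> 'b::monoid_add"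
  assumes h: "\<And>x y. h (x + y) = h x + h y"
  shows "push h (f * g) = push h f * push h g"
proof -
  have "push h (f * g) = push h ((\<Sum>m\<in>Poly_Mapping.keys f. Poly_Mapping.single m (Poly_Mapping.lookup f m)) *
    (\<Sum>n\<in>Poly_Mapping.keys g. Poly_Mapping.single n (Poly_Mapping.lookup g n)))"
    by (simp only: poly_mapping_expansion)
  also have "\<dots> = push h f * push h g"
    by (simp add: sum_product mult_single push_sum h) (simp add: push_def sum_product mult_single h)
  finally show ?thesis .
qed

lemma prod_single:
  "(\<Prod>i\<in>A. Poly_Mapping.single (f i) (1::'k::comm_semiring_1)) =
    Poly_Mapping.single (\<Sum>i\<in>A. f i :: 'a::comm_monoid_add) 1"
  by (induction A rule: infinite_finite_induct) (simp_all add: mult_single)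

lemma single_sum: "Poly_Mapping.single k (\<Sum>i\<in>A. f i) = (\<Sum>i\<in>A. Poly_Mapping.single k (f i))"
  by (induction A rule: infinite_finite_induct) (simp_all add: single_add)

lemma pvar_power: "pvar v ^ n = Poly_Mapping.single (Poly_Mapping.single v n) 1"
  by (induction n) (simp_all add: pvar_def mult_single single_add[symmetric])

subsection \<open>Ideals of polynomial subrings\<close>

lemma mpoly_carrier_iff:
  "f \<in> carrier (mpoly_ring V) \<longleftrightarrow> (\<forall>m\<in>Poly_Mapping.keys f. Poly_Mapping.keys m \<subseteq> V)"
  by (simp add: mpoly_ring_def)

lemma mpoly_ring_simps [simp]:
  "f \<otimes>\<^bsub>mpoly_ring V\<^esub> g = f * g" "f \<oplus>\<^bsub>mpoly_ring V\<^esub> g = f + g"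
  "\<one>\<^bsub>mpoly_ring V\<^esub> = 1" "\<zero>\<^bsub>mpoly_ring V\<^esub> = 0"
  by (simp_all add: mpoly_ring_def)

lemma mpoly_ring_a_inv:
  assumes "f \<in> carrier (mpoly_ring V)"
  shows "\<ominus>\<^bsub>mpoly_ring V\<^esub> f = - f"
proof -
  interpret cring "mpoly_ring V :: ('a, 'b) mpoly ring" by (rule mpoly_ring_cring)
  show ?thesis
    using r_neg[OF assms] by (simp add: eq_neg_iff_add_eq_0 add.commute)
qed

lemma mpoly_carrier_closed:
  fixes f g :: "('v, 'k::comm_ring_1) mpoly"
  shows mpoly_one_closed: "1 \<in> carrier (mpoly_ring V :: ('v, 'k) mpoly ring)"
    and mpoly_pvar_closed: "v \<in> V \<Longrightarrow> pvar v \<in> carrier (mpoly_ring V :: ('v, 'k) mpoly ring)"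
    and mpoly_mult_closed:
      "f \<in> carrier (mpoly_ring V) \<Longrightarrow> g \<in> carrier (mpoly_ring V) \<Longrightarrow> f * g \<in> carrier (mpoly_ring V)"
    and mpoly_diff_closed:
      "f \<in> carrier (mpoly_ring V) \<Longrightarrow> g \<in> carrier (mpoly_ring V) \<Longrightarrow> f - g \<in> carrier (mpoly_ring V)"
proof -
  interpret cring "mpoly_ring V :: ('v, 'k) mpoly ring" by (rule mpoly_ring_cring)
  show "1 \<in> carrier (mpoly_ring V :: ('v, 'k) mpoly ring)"
    "v \<in> V \<Longrightarrow> pvar v \<in> carrier (mpoly_ring V :: ('v, 'k) mpoly ring)"
    by (simp_all add: pvar_def mpoly_carrier_iff)
  show "f \<in> carrier (mpoly_ring V) \<Longrightarrow> g \<in> carrier (mpoly_ring V) \<Longrightarrow> f * g \<in> carrier (mpoly_ring V)"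
    using m_closed[of f g] by (simp only: mpoly_ring_simps)
  have "f + (- 1) * g \<in> carrier (mpoly_ring V)"
    if "f \<in> carrier (mpoly_ring V)" "g \<in> carrier (mpoly_ring V)"
  proof -
    have "- 1 \<in> carrier (mpoly_ring V :: ('v, 'k) mpoly ring)"
      by (simp add: mpoly_carrier_iff in_keys_iff lookup_one when_def)
    then show ?thesis
      using that a_closed[of f "(- 1) * g"] m_closed[of "- 1" g]
      by (simp only: mpoly_ring_simps)
  qed
  then show "f \<in> carrier (mpoly_ring V) \<Longrightarrow> g \<in> carrier (mpoly_ring V) \<Longrightarrow> f - g \<in> carrier (mpoly_ring V)"
    by simp
qed

lemma mpoly_power_closed:
  "f \<in> carrier (mpoly_ring V) \<Longrightarrow> f ^ n \<in> carrier (mpoly_ring V)"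
  by (induction n) (simp_all add: mpoly_one_closed mpoly_mult_closed)

lemma mpoly_prod_closed:
  "(\<And>i. i \<in> A \<Longrightarrow> f i \<in> carrier (mpoly_ring V)) \<Longrightarrow> (\<Prod>i\<in>A. f i) \<in> carrier (mpoly_ring V)"
  by (induction A rule: infinite_finite_induct)
    (simp_all add: mpoly_one_closed mpoly_mult_closed)

section \<open>Ideals of a polynomial ring: contraction, congruence and units modulo an
  ideal\<close>

context
  fixes V :: "'v set" and I :: "('v, 'k::comm_ring_1) mpoly set"
  assumes I: "ideal I (mpoly_ring V)"
begin

lemma mpoly_ideal_0: "0 \<in> I"
  using additive_subgroup.zero_closed[OF ideal.axioms(1)[OF I]] by simp

lemma mpoly_ideal_add: "f \<in> I \<Longrightarrow> g \<in> I \<Longrightarrow> f + g \<in> I"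
  using additive_subgroup.a_closed[OF ideal.axioms(1)[OF I], of f g] by simp

lemma mpoly_ideal_mult: "f \<in> I \<Longrightarrow> c \<in> carrier (mpoly_ring V) \<Longrightarrow> c * f \<in> I"
  using ideal.I_l_closed[OF I, of f c] by simp

lemma mpoly_ideal_uminus: "f \<in> I \<Longrightarrow> - f \<in> I"
proof -
  have "- 1 \<in> carrier (mpoly_ring V :: ('v, 'k) mpoly ring)"
    by (simp add: mpoly_carrier_iff in_keys_iff lookup_one when_def)
  then show "f \<in> I \<Longrightarrow> - f \<in> I" using mpoly_ideal_mult[of f "- 1"] by simp
qed

lemma mpoly_ideal_sum: "(\<And>i. i \<in> A \<Longrightarrow> f i \<in> I) \<Longrightarrow> (\<Sum>i\<in>A. f i) \<in> I"
  by (induction A rule: infinite_finite_induct) (simp_all add: mpoly_ideal_0 mpoly_ideal_add)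

text \<open>Multipliers from the smaller ring are multipliers in the larger one. For H and the
  variables a, b this makes the elimination ideal an ideal of k[a,b].\<close>

lemma mpoly_ideal_contraction:
  assumes U: "U \<subseteq> V"
  shows "ideal (carrier (mpoly_ring U) \<inter> I) (mpoly_ring U)" (is "ideal ?J ?R")
proof -
  interpret cring ?R by (rule mpoly_ring_cring)
  have sub: "f \<in> carrier (mpoly_ring V)" if "f \<in> carrier ?R" for f
    using that U by (auto simp: mpoly_carrier_iff)
  show ?thesis
  proof (rule idealI)
    show "subgroup ?J (add_monoid ?R)"
    proof (rule add.subgroupI)
      show "?J \<noteq> {}"
        using zero_closed mpoly_ideal_0 by auto
      show "\<ominus>\<^bsub>?R\<^esub> f \<in> ?J" if "f \<in> ?J" for f
        using that a_inv_closed[of f] mpoly_ideal_uminus by (simp add: mpoly_ring_a_inv)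
      show "f \<oplus>\<^bsub>?R\<^esub> g \<in> ?J" if "f \<in> ?J" "g \<in> ?J" for f g
        using that a_closed[of f g] mpoly_ideal_add by simp
    qed blast
    show "x \<otimes>\<^bsub>?R\<^esub> a \<in> ?J" "a \<otimes>\<^bsub>?R\<^esub> x \<in> ?J" if "a \<in> ?J" "x \<in> carrier ?R" for a x
      using that m_closed[of x a] mpoly_ideal_mult[OF _ sub, of a x] by (simp_all add: mult.commute)
  qed unfold_locales
qed

text \<open>Membership of both sides in the carrier is part of the relation, because replacing one
  factor of a product uses the other factors as ring multipliers.\<close>

definition icong :: "('v, 'k) mpoly \<Rightarrow> ('v, 'k) mpoly \<Rightarrow> bool" where
  "icong f g \<longleftrightarrow> f \<in> carrier (mpoly_ring V) \<and> g \<in> carrier (mpoly_ring V) \<and> f - g \<in> I"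

lemma icong_refl: "f \<in> carrier (mpoly_ring V) \<Longrightarrow> icong f f"
  by (simp add: icong_def mpoly_ideal_0)

lemma icong_sym: "icong f g \<Longrightarrow> icong g f"
  using mpoly_ideal_uminus[of "f - g"] by (simp add: icong_def)

lemma icong_trans: "icong f g \<Longrightarrow> icong g h \<Longrightarrow> icong f h"
  using mpoly_ideal_add[of "f - g" "g - h"] by (simp add: icong_def)

lemma icong_mult:
  assumes "icong f f'" "icong g g'" shows "icong (f * g) (f' * g')"
proof -
  have "g * (f - f') + f' * (g - g') \<in> I"
    using assms by (auto simp: icong_def intro: mpoly_ideal_add mpoly_ideal_mult)
  moreover have "g * (f - f') + f' * (g - g') = f * g - f' * g'"
    by (simp add: algebra_simps)
  ultimately show ?thesis
    using assms by (simp add: icong_def mpoly_mult_closed)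
qed

lemma icong_power: "icong f g \<Longrightarrow> icong (f ^ n) (g ^ n)"
  by (induction n) (simp_all add: icong_refl icong_mult mpoly_one_closed)

lemma icong_prod: "(\<And>i. i \<in> A \<Longrightarrow> icong (f i) (g i)) \<Longrightarrow> icong (\<Prod>i\<in>A. f i) (\<Prod>i\<in>A. g i)"
  by (induction A rule: infinite_finite_induct)
    (simp_all add: icong_refl icong_mult mpoly_one_closed)

text \<open>These are the elements whose class is a unit of the quotient ring; they serve to cancel
  powers of \<open>gamma1\<close> modulo H.\<close>

definition iunit :: "('v, 'k) mpoly \<Rightarrow> bool" where
  "iunit f \<longleftrightarrow> (\<exists>g. g \<in> carrier (mpoly_ring V) \<and> icong (g * f) 1)"

lemma iunit_mult:
  assumes "iunit f" "iunit g" shows "iunit (f * g)"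
proof -
  obtain f' g' where *: "f' \<in> carrier (mpoly_ring V)" "icong (f' * f) 1"
    "g' \<in> carrier (mpoly_ring V)" "icong (g' * g) 1"
    using assms by (auto simp: iunit_def)
  then have "icong ((f' * f) * (g' * g)) (1 * 1)" by (intro icong_mult)
  with * show ?thesis
    unfolding iunit_def by (intro exI[of _ "f' * g'"]) (simp add: mpoly_mult_closed mult_ac)
qed

lemma iunit_1: "iunit 1"
  unfolding iunit_def by (intro exI[of _ 1]) (simp add: icong_refl mpoly_one_closed)

lemma iunit_power: "iunit f \<Longrightarrow> iunit (f ^ n)"
  by (induction n) (simp_all add: iunit_1 iunit_mult)

lemma iunit_prod: "(\<And>i. i \<in> A \<Longrightarrow> iunit (f i)) \<Longrightarrow> iunit (\<Prod>i\<in>A. f i)"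
  by (induction A rule: infinite_finite_induct) (simp_all add: iunit_1 iunit_mult)

lemma iunit_cancel:
  assumes u: "iunit u" and uf: "icong (u * f) (u * g)"
    and f: "f \<in> carrier (mpoly_ring V)" and g: "g \<in> carrier (mpoly_ring V)"
  shows "icong f g"
proof -
  obtain v where v: "v \<in> carrier (mpoly_ring V)" "icong (v * u) 1"
    using u by (auto simp: iunit_def)
  have *: "icong (v * u * h) h" if "h \<in> carrier (mpoly_ring V)" for h
    using icong_mult[OF v(2) icong_refl[OF that]] by simp
  have "icong (v * u * f) (v * u * g)"
    using icong_mult[OF icong_refl[OF v(1)] uf] by (simp add: mult.assoc)
  then show ?thesis
    using *[OF f] *[OF g] icong_sym icong_trans by blast
qed

end

text \<open>In the domain \<open>'r\<close> a product vanishes only if a factor does, and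
  \<open>h 1 = 1\<close> makes the kernel proper.\<close>

lemma kernel_primeideal:
  fixes h :: "('v, 'k::comm_ring_1) mpoly \<Rightarrow> 'r::idom"
  assumes add: "\<And>f g. h (f + g) = h f + h g" and mult: "\<And>f g. h (f * g) = h f * h g"
    and one: "h 1 = 1"
  shows "primeideal {f \<in> carrier (mpoly_ring V). h f = 0} (mpoly_ring V)"
    (is "primeideal ?J ?R")
proof -
  interpret cring ?R by (rule mpoly_ring_cring)
  have zero: "h 0 = 0" using add[of 0 0] by (simp only: add_0 add_cancel_right_right)
  have uminus: "h (- f) = - h f" for f
    using add[of f "- f"] zero by (simp add: eq_neg_iff_add_eq_0 add.commute)
  show ?thesis
  proof (rule primeidealI)
    show "ideal ?J ?R"
    proof (rule idealI)
      show "ring ?R" by unfold_locales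
      show "subgroup ?J (add_monoid ?R)"
      proof (rule add.subgroupI)
        show "?J \<subseteq> carrier ?R" by blast
        show "?J \<noteq> {}" using zero_closed zero by auto
        show "\<ominus>\<^bsub>?R\<^esub> f \<in> ?J" if "f \<in> ?J" for f
          using that a_inv_closed[of f] by (simp add: mpoly_ring_a_inv uminus)
        show "f \<oplus>\<^bsub>?R\<^esub> g \<in> ?J" if "f \<in> ?J" "g \<in> ?J" for f g
          using that a_closed[of f g] by (simp add: add)
      qed
      show "x \<otimes>\<^bsub>?R\<^esub> a \<in> ?J" "a \<otimes>\<^bsub>?R\<^esub> x \<in> ?J" if "a \<in> ?J" "x \<in> carrier ?R" for a x
        using that m_closed[of a x] m_closed[of x a] by (simp_all add: mult)
    qed
    show "cring ?R" by unfold_locales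
    have "1 \<notin> ?J" using one by simp
    then show "carrier ?R \<noteq> ?J" using mpoly_one_closed by metis
    show "a \<in> ?J \<or> b \<in> ?J" if "a \<in> carrier ?R" "b \<in> carrier ?R" "a \<otimes>\<^bsub>?R\<^esub> b \<in> ?J" for a b
      using that by (simp add: mult)
  qed
qed


subsection \<open>The variables of the Sibirsky ideal\<close>

abbreviation varA :: "int \<times> nat \<Rightarrow> sib_var" where "varA \<equiv> \<lambda>(p, q). VarA p q"
abbreviation varB :: "int \<times> nat \<Rightarrow> sib_var" where "varB \<equiv> \<lambda>(p, q). VarB q p"
abbreviation dif :: "int \<times> nat \<Rightarrow> int" where "dif \<equiv> \<lambda>(p, q). p - int q"

text \<open>Reversing an exponent vector amounts to exchanging a_pq with b_qp; this is that exchange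
  on single variables.\<close>

definition swap_ab :: "sib_var \<Rightarrow> sib_var" where
  "swap_ab v = (case v of VarA p q \<Rightarrow> VarB q p | VarB q p \<Rightarrow> VarA p q | _ \<Rightarrow> v)"

lemma length_ab_list [simp]: "length (ab_list S) = 2 * length S"
  by (simp add: ab_list_def)

lemma set_ab_list: "set (ab_list S) = varA ` set S \<union> varB ` set S"
  by (simp add: ab_list_def)

lemma distinct_ab_list: "distinct S \<Longrightarrow> distinct (ab_list S)"
  by (auto simp: ab_list_def distinct_map inj_on_def)

lemma rev_ab_list: "rev (ab_list S) = map swap_ab (ab_list S)"
  by (auto simp: ab_list_def rev_map swap_ab_def)

lemma sum_ab_list:
  "(\<Sum>v\<in>set (ab_list S). f v) = (\<Sum>x\<in>set S. f (varA x) + f (varB x))"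
proof -
  have "(\<Sum>v\<in>set (ab_list S). f v) = (\<Sum>v\<in>varA ` set S. f v) + (\<Sum>v\<in>varB ` set S. f v)"
    unfolding set_ab_list by (rule sum.union_disjoint) auto
  also have "\<dots> = (\<Sum>x\<in>set S. f (varA x)) + (\<Sum>x\<in>set S. f (varB x))"
    by (subst (1 2) sum.reindex) (auto simp: inj_on_def)
  finally show ?thesis by (simp add: sum.distrib)
qed

text \<open>The b half is listed in reverse, so a and b of the same pair sit at mirror positions;
  counting from 0, the mirror of \<open>j\<close> is \<open>2 * length S - Suc j\<close>.\<close>

lemma ab_list_nth:
  assumes "j < length S"
  shows "ab_list S ! j = varA (S ! j)"
    and "ab_list S ! (2 * length S - Suc j) = varB (S ! j)"
    and "zeta S ! j = dif (S ! j)"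
    and "zeta S ! (2 * length S - Suc j) = - dif (S ! j)"
  using assms by (auto simp: ab_list_def zeta_def nth_append rev_nth split: prod.splits)

section \<open>Folding sums and products along mirror positions\<close>

lemma bij_betw_upper_half: "bij_betw (\<lambda>j. 2 * n - Suc j) {..<n} {n..<2 * n}"
  by (rule bij_betw_byWitness[where f' = "\<lambda>j. 2 * n - Suc j"]) auto

lemma lessThan_double: "{..<2 * n} = {..<n} \<union> {n..<2 * (n :: nat)}"
  by auto

lemma prod_fold_halves:
  fixes f :: "nat \<Rightarrow> 'a::comm_monoid_mult"
  shows "(\<Prod>i<2 * n. f i) = (\<Prod>j<n. f j * f (2 * n - Suc j))"
proof -
  have "(\<Prod>i<2 * n. f i) = (\<Prod>i<n. f i) * (\<Prod>i\<in>{n..<2 * n}. f i)"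
    unfolding lessThan_double by (rule prod.union_disjoint) auto
  then show ?thesis
    by (simp add: prod.distrib prod.reindex_bij_betw[OF bij_betw_upper_half, symmetric])
qed

lemma sum_fold_halves:
  fixes f :: "nat \<Rightarrow> 'a::comm_monoid_add"
  shows "(\<Sum>i<2 * n. f i) = (\<Sum>j<n. f j + f (2 * n - Suc j))"
proof -
  have "(\<Sum>i<2 * n. f i) = (\<Sum>i<n. f i) + (\<Sum>i\<in>{n..<2 * n}. f i)"
    unfolding lessThan_double by (rule sum.union_disjoint) auto
  then show ?thesis
    by (simp add: sum.distrib sum.reindex_bij_betw[OF bij_betw_upper_half, symmetric])
qed

lemma sib_monom_halves:
  "sib_monom S \<nu> =
    (\<Prod>j<length S. pvar (varA (S ! j)) ^ (\<nu> ! j) * pvar (varB (S ! j)) ^ (\<nu> ! (2 * length S - Suc j)))"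
  unfolding sib_monom_def prod_fold_halves
  by (rule prod.cong) (simp_all add: ab_list_nth)

text \<open>Mirror positions carry opposite entries of \<open>zeta S\<close>, so only the difference
  of the two exponents of each pair matters.\<close>

lemma sib_monoid_iff:
  "\<nu> \<in> sib_monoid S \<longleftrightarrow> length \<nu> = 2 * length S \<and>
    (\<Sum>j<length S. dif (S ! j) * (int (\<nu> ! j) - int (\<nu> ! (2 * length S - Suc j)))) = 0"
proof -
  have "(\<Sum>i<2 * length S. zeta S ! i * int (\<nu> ! i)) =
    (\<Sum>j<length S. dif (S ! j) * (int (\<nu> ! j) - int (\<nu> ! (2 * length S - Suc j))))"
    unfolding sum_fold_halves
    by (rule sum.cong) (simp_all add: ab_list_nth right_diff_distrib)
  then show ?thesis by (simp add: sib_monoid_def)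
qed

lemma sib_monom_closed: "sib_monom S \<nu> \<in> carrier (ring_ab S)"
  unfolding sib_monom_def
  by (intro mpoly_prod_closed mpoly_power_closed mpoly_pvar_closed) simp

text \<open>Distinct pairs give distinct variables, so the product over positions can be reindexed
  as a product over variables. Thus every monomial of k[a,b] is some [nu].\<close>

lemma sib_monom_eq_single:
  assumes "distinct S" "Poly_Mapping.keys m \<subseteq> set (ab_list S)"
  shows "sib_monom S (map (Poly_Mapping.lookup m) (ab_list S)) = Poly_Mapping.single m 1"
proof -
  let ?L = "ab_list S" and ?n = "2 * length S"
  have bij: "bij_betw ((!) ?L) {..<?n} (set ?L)"
    using bij_betw_nth[OF distinct_ab_list[OF assms(1)]] by simp
  have "sib_monom S (map (Poly_Mapping.lookup m) ?L) =
      (\<Prod>i<?n. pvar (?L ! i) ^ Poly_Mapping.lookup m (?L ! i))"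
    unfolding sib_monom_def by (rule prod.cong) simp_all
  also have "\<dots> = (\<Prod>v\<in>set ?L. pvar v ^ Poly_Mapping.lookup m v)"
    by (rule prod.reindex_bij_betw[OF bij])
  also have "\<dots> = Poly_Mapping.single m 1"
    by (simp add: pvar_power prod_single poly_mapping_expansion_superset assms(2))
  finally show ?thesis .
qed

subsection \<open>The toric parametrisation\<close>

(* Exponents of Laurent monomials: index 0 belongs to gamma, and Suc (to_nat (p, q)) to the
   t-variable of the pair (p, q). Linearly ordered indices are what makes the Laurent polynomials
   an instance of idom. *)
definition toric_weight :: "(int \<times> nat) list \<Rightarrow> sib_var \<Rightarrow> nat \<Rightarrow>\<^sub>0 int" where
  "toric_weight S v = (case v of
      VarA p q \<Rightarrow> Poly_Mapping.single (Suc (to_nat (p, q))) 1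
    | VarB q p \<Rightarrow> Poly_Mapping.single (Suc (to_nat (p, q))) 1 + Poly_Mapping.single 0 (p - int q)
    | VarT j \<Rightarrow> Poly_Mapping.single (Suc (to_nat (S ! j))) 1
    | VarGamma \<Rightarrow> Poly_Mapping.single 0 1
    | VarW \<Rightarrow> Poly_Mapping.single 0 (- (\<Sum>j<length S. int (nat (- dif (S ! j))))))"

text \<open>The additive extension of the weights from variables to exponents;
  \<open>frag_cmul\<close> is the integer multiple in a free abelian group.\<close>

definition toric_exp :: "(int \<times> nat) list \<Rightarrow> (sib_var \<Rightarrow>\<^sub>0 nat) \<Rightarrow> nat \<Rightarrow>\<^sub>0 int" where
  "toric_exp S m = (\<Sum>v\<in>Poly_Mapping.keys m. frag_cmul (int (Poly_Mapping.lookup m v)) (toric_weight S v))"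

text \<open>The target is the group algebra of the free abelian group
  \<open>nat \<Rightarrow>\<^sub>0 int\<close>, that is, Laurent polynomials in countably many
  variables.\<close>

abbreviation toric :: "(int \<times> nat) list \<Rightarrow> (sib_var, 'k::comm_ring_1) mpoly \<Rightarrow> (nat \<Rightarrow>\<^sub>0 int) \<Rightarrow>\<^sub>0 'k" where
  "toric S \<equiv> push (toric_exp S)"

lemma toric_exp_superset:
  assumes "finite A" "Poly_Mapping.keys m \<subseteq> A"
  shows "toric_exp S m = (\<Sum>v\<in>A. frag_cmul (int (Poly_Mapping.lookup m v)) (toric_weight S v))"
  unfolding toric_exp_def
  by (rule sum.mono_neutral_left) (use assms in \<open>auto simp: in_keys_iff\<close>)

lemma toric_exp_add: "toric_exp S (m + n) = toric_exp S m + toric_exp S n"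
proof -
  let ?A = "Poly_Mapping.keys m \<union> Poly_Mapping.keys n"
  have "Poly_Mapping.keys (m + n) \<subseteq> ?A" by (rule Poly_Mapping.keys_add)
  then show ?thesis
    by (simp add: toric_exp_superset[of ?A] lookup_add frag_cmul_distrib sum.distrib)
qed

lemma toric_exp_0 [simp]: "toric_exp S 0 = 0"
  by (simp add: toric_exp_def)

lemma toric_exp_single: "toric_exp S (Poly_Mapping.single v n) = frag_cmul (int n) (toric_weight S v)"
  by (subst toric_exp_superset[of "{v}"]) auto

(* On exponents these would rewrite powers of the variable 0 into numerals. *)
declare single_one [simp del] single_of_nat [simp del]

lemma toric_mult: "toric S (f * g) = toric S f * toric S g"
  by (rule push_mult) (rule toric_exp_add)

lemma toric_1 [simp]: "toric S (1 :: (sib_var, 'k::comm_ring_1) mpoly) = 1"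
  using push_single[of "toric_exp S" 0 "1 :: 'k"] by (simp only: single_one toric_exp_0)

lemma toric_pvar: "toric S (pvar v) = Poly_Mapping.single (toric_weight S v) 1"
  by (simp add: pvar_def toric_exp_single)

lemma toric_prod: "toric S (\<Prod>i\<in>A. f i) = (\<Prod>i\<in>A. toric S (f i))"
  by (induction A rule: infinite_finite_induct) (simp_all add: toric_mult)

lemma toric_pvar_gamma_power:
  "toric S (pvar VarGamma ^ n) = Poly_Mapping.single (Poly_Mapping.single 0 (int n)) 1"
proof -
  have "frag_cmul (int n) (Poly_Mapping.single 0 1) = Poly_Mapping.single (0::nat) (int n)"
    by (rule poly_mapping_eqI) (simp add: lookup_single when_def)
  then show ?thesis
    by (simp add: pvar_power toric_exp_single toric_weight_def)
qed

lemma gamma1_eq: "gamma1 x = pvar VarGamma ^ nat (- dif x)"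
  by (auto simp: gamma1_def split: prod.splits)

lemma gamma2_eq: "gamma2 x = pvar VarGamma ^ nat (dif x)"
  by (auto simp: gamma2_def split: prod.splits)

text \<open>\<open>V\<close> stays arbitrary for two uses: on all variables the kernel is an ideal
  containing H, on a and b it is the prime ideal with which both ideals get identified.\<close>

lemma toric_kernel_primeideal:
  "primeideal {f \<in> carrier (mpoly_ring V). toric S f = (0 :: _ \<Rightarrow>\<^sub>0 'k::idom)} (mpoly_ring V)"
  by (rule kernel_primeideal) (simp_all add: push_add toric_mult)

subsection \<open>Inclusions between the three ideals\<close>

definition gens_H :: "(int \<times> nat) list \<Rightarrow> (sib_var, 'k::comm_ring_1) mpoly set" where
  "gens_H S = {1 - pvar VarW * (\<Prod>j<length S. gamma1 (S ! j))}
      \<union> {pvar (VarA p q) - pvar (VarT j) | j p q. j < length S \<and> S ! j = (p, q)}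
      \<union> {gamma1 (p, q) * pvar (VarB q p) - gamma2 (p, q) * pvar (VarT j) | j p q.
           j < length S \<and> S ! j = (p, q)}"

lemma ideal_H_eq: "ideal_H S = genideal (ring_abtgw S) (gens_H S)"
  by (simp add: ideal_H_def gens_H_def)

lemma gens_H_closed: "gens_H S \<subseteq> carrier (ring_abtgw S)"
proof -
  have "VarA p q \<in> set (ab_list S)" "VarB q p \<in> set (ab_list S)"
    if "j < length S" "S ! j = (p, q)" for j p q
    using nth_mem[OF that(1)] that(2) by (force simp: set_ab_list)+
  then show ?thesis
    unfolding gens_H_def gamma1_eq gamma2_eq
    by (auto intro!: mpoly_diff_closed mpoly_mult_closed mpoly_power_closed mpoly_prod_closed
        mpoly_pvar_closed mpoly_one_closed)
qed

lemma ideal_ideal_H: "ideal (ideal_H S) (ring_abtgw S)"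
  unfolding ideal_H_eq
  using ring.genideal_ideal[OF cring.axioms(1)[OF mpoly_ring_cring] gens_H_closed] .

lemma gens_H_subset: "gens_H S \<subseteq> ideal_H S"
  unfolding ideal_H_eq
  using ring.genideal_self[OF cring.axioms(1)[OF mpoly_ring_cring] gens_H_closed] .

text \<open>The weight of w is opposite to that of the product of all \<open>gamma1\<close>; a and t
  of one pair have equal weight; in the third kind \<open>gamma1\<close> and \<open>gamma2\<close>
  compensate the power of gamma in the image of b.\<close>

lemma toric_gens_H:
  assumes "f \<in> gens_H S" shows "toric S f = 0"
proof -
  have "toric S (1 - pvar VarW * (\<Prod>j<length S. gamma1 (S ! j))) = (0 :: _ \<Rightarrow>\<^sub>0 'a)"
    by (simp add: push_diff toric_mult toric_pvar toric_prod gamma1_eq toric_pvar_gamma_power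
        prod_single mult_single toric_weight_def single_sum[symmetric] single_add[symmetric])
      (simp add: single_one)
  moreover have "toric S (pvar (VarA p q) - pvar (VarT j)) = (0 :: _ \<Rightarrow>\<^sub>0 'a)"
    if "S ! j = (p, q)" for j p q
    using that by (simp add: push_diff toric_pvar toric_weight_def)
  moreover have "toric S (gamma1 (p, q) * pvar (VarB q p) - gamma2 (p, q) * pvar (VarT j)) = (0 :: _ \<Rightarrow>\<^sub>0 'a)"
    if "S ! j = (p, q)" for j p q
  proof -
    let ?T = "Poly_Mapping.single (Suc (to_nat (p, q))) (1::int)"
    \<comment> \<open>In the gamma exponent this is max(q-p, 0) + (p-q) = max(p-q, 0).\<close>
    have shift: "Poly_Mapping.single 0 (int (nat (int q - p))) + Poly_Mapping.single (0::nat) (p - int q)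
      = Poly_Mapping.single 0 (int (nat (p - int q)))"
      by (simp flip: single_add)
    have "Poly_Mapping.single 0 (int (nat (int q - p))) + (?T + Poly_Mapping.single 0 (p - int q))
      = Poly_Mapping.single 0 (int (nat (p - int q))) + ?T"
      by (subst add.left_commute, subst shift, rule add.commute)
    moreover have "toric S (gamma1 (p, q) * pvar (VarB q p)) = Poly_Mapping.single
        (Poly_Mapping.single 0 (int (nat (int q - p))) + (?T + Poly_Mapping.single 0 (p - int q))) (1::'a)"
      by (simp add: toric_mult toric_pvar gamma1_eq toric_pvar_gamma_power mult_single toric_weight_def)
    moreover have "toric S (gamma2 (p, q) * pvar (VarT j)) = Poly_Mapping.single
        (Poly_Mapping.single 0 (int (nat (p - int q))) + ?T) (1::'a)"
      using that
      by (simp add: toric_mult toric_pvar gamma2_eq toric_pvar_gamma_power mult_single toric_weight_def)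
    ultimately show ?thesis
      by (simp only: push_diff) simp
  qed
  ultimately show ?thesis
    using assms unfolding gens_H_def by blast
qed

text \<open>The kernel on the extended ring is an ideal containing the generators, and
  \<open>genideal\<close> is the least such ideal.\<close>

lemma ideal_H_subset_kernel:
  "(ideal_H S :: (sib_var, 'k::idom) mpoly set) \<subseteq> {f \<in> carrier (ring_abtgw S). toric S f = 0}"
  unfolding ideal_H_eq
proof (rule ring.genideal_minimal)
  show "ring (ring_abtgw S :: (sib_var, 'k) mpoly ring)"
    by (rule cring.axioms(1)[OF mpoly_ring_cring])
  show "ideal {f \<in> carrier (ring_abtgw S). toric S f = (0 :: _ \<Rightarrow>\<^sub>0 'k)} (ring_abtgw S)"
    by (rule primeideal.axioms(1)[OF toric_kernel_primeideal])
qed (use gens_H_closed toric_gens_H in blast)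

lemma sib_gens_closed:
  "{sib_monom S \<nu> - sib_monom S (rev \<nu>) | \<nu>. \<nu> \<in> sib_monoid S} \<subseteq> carrier (ring_ab S)"
  by (auto intro: mpoly_diff_closed sib_monom_closed)

lemma ideal_sibirsky_ideal: "ideal (sibirsky_ideal S) (ring_ab S)"
  unfolding sibirsky_ideal_def
  using ring.genideal_ideal[OF cring.axioms(1)[OF mpoly_ring_cring] sib_gens_closed] .

lemma sib_gens_subset:
  "\<nu> \<in> sib_monoid S \<Longrightarrow> sib_monom S \<nu> - sib_monom S (rev \<nu>) \<in> sibirsky_ideal S"
  unfolding sibirsky_ideal_def
  using ring.genideal_self[OF cring.axioms(1)[OF mpoly_ring_cring] sib_gens_closed, of S] by blast


section \<open>Calculation modulo H: the Sibirsky ideal lies in the elimination ideal\<close>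

lemma gamma_closed:
  assumes "VarGamma \<in> V"
  shows "gamma1 x \<in> carrier (mpoly_ring V)" "gamma2 x \<in> carrier (mpoly_ring V)"
  unfolding gamma1_eq gamma2_eq by (simp_all add: mpoly_power_closed mpoly_pvar_closed assms)

abbreviation H_vars :: "(int \<times> nat) list \<Rightarrow> sib_var set" where
  "H_vars S \<equiv> set (ab_list S) \<union> VarT ` {..<length S} \<union> {VarGamma, VarW}"

abbreviation H_cong ::
  "(int \<times> nat) list \<Rightarrow> (sib_var, 'k::comm_ring_1) mpoly \<Rightarrow> (sib_var, 'k) mpoly \<Rightarrow> bool" where
  "H_cong S \<equiv> icong (H_vars S) (ideal_H S)"

lemmas H_closed = mpoly_mult_closed mpoly_power_closed mpoly_prod_closed mpoly_pvar_closed
  mpoly_one_closed gamma_closed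

lemma ab_vars_mem:
  assumes "j < length S"
  shows "varA (S ! j) \<in> set (ab_list S)" "varB (S ! j) \<in> set (ab_list S)"
  using nth_mem[OF assms] by (simp_all only: set_ab_list) blast+

lemma H_cong_gens:
  assumes j: "j < length S"
  shows "H_cong S (pvar (varA (S ! j))) (pvar (VarT j))"
    and "H_cong S (gamma1 (S ! j) * pvar (varB (S ! j))) (gamma2 (S ! j) * pvar (VarT j))"
proof -
  obtain p q where pq: "S ! j = (p, q)" by fastforce
  have gens: "pvar (varA (S ! j)) - pvar (VarT j) \<in> gens_H S"
    "gamma1 (S ! j) * pvar (varB (S ! j)) - gamma2 (S ! j) * pvar (VarT j) \<in> gens_H S"
    using j pq unfolding gens_H_def by auto
  have vars: "varA (S ! j) \<in> H_vars S" "varB (S ! j) \<in> H_vars S"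
    "VarT j \<in> H_vars S" "VarGamma \<in> H_vars S"
    using ab_vars_mem[OF j] j by auto
  show "H_cong S (pvar (varA (S ! j))) (pvar (VarT j))"
    "H_cong S (gamma1 (S ! j) * pvar (varB (S ! j))) (gamma2 (S ! j) * pvar (VarT j))"
    unfolding icong_def[OF ideal_ideal_H]
    by (intro conjI H_closed vars gens[THEN subsetD[OF gens_H_subset]])+
qed

text \<open>The first generator of H makes w an inverse of the product of all \<open>gamma1\<close>;
  hence w times the product of the other factors inverts the one at \<open>j\<close>.\<close>

lemma iunit_gamma1:
  assumes j: "j < length S"
  shows "iunit (H_vars S) (ideal_H S :: (sib_var, 'k::comm_ring_1) mpoly set) (gamma1 (S ! j))"
proof -
  let ?G = "\<Prod>i<length S. gamma1 (S ! i) :: (sib_var, 'k) mpoly"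
  let ?G' = "\<Prod>i\<in>{..<length S} - {j}. gamma1 (S ! i) :: (sib_var, 'k) mpoly"
  have vars: "VarW \<in> H_vars S" "VarGamma \<in> H_vars S" by simp_all
  have "1 - pvar VarW * ?G \<in> ideal_H S"
    using gens_H_subset[of S] unfolding gens_H_def by blast
  then have "H_cong S 1 (pvar VarW * ?G)"
    unfolding icong_def[OF ideal_ideal_H] by (intro conjI H_closed vars)
  then have "H_cong S (pvar VarW * ?G) 1"
    by (rule icong_sym[OF ideal_ideal_H])
  moreover have "?G = gamma1 (S ! j) * ?G'"
    using j by (simp add: prod.remove)
  ultimately have "H_cong S ((pvar VarW * ?G') * gamma1 (S ! j)) 1"
    by (simp only: mult_ac)
  moreover have "pvar VarW * ?G' \<in> carrier (ring_abtgw S)"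
    by (intro H_closed vars)
  ultimately show ?thesis
    unfolding iunit_def[OF ideal_ideal_H] by blast
qed

text \<open>Here \<open>e\<close> and \<open>f\<close> are the exponents of a and b. Each b needs
  one \<open>gamma1\<close> to become \<open>gamma2\<close> times t; the surplus power
  \<open>e j\<close> makes the multiplier symmetric in \<open>e\<close> and \<open>f\<close>. The t
  part is symmetric too, so exchanging \<open>e\<close> and \<open>f\<close> affects only the power
  of gamma.\<close>

lemma H_cong_normal_form:
  fixes e f :: "nat \<Rightarrow> nat" and S :: "(int \<times> nat) list"
  shows "H_cong S
    ((\<Prod>j<length S. gamma1 (S ! j) ^ (e j + f j)) *
      (\<Prod>j<length S. pvar (varA (S ! j)) ^ e j * pvar (varB (S ! j)) ^ f j))
    (pvar VarGamma ^ (\<Sum>j<length S. nat (- dif (S ! j)) * e j + nat (dif (S ! j)) * f j) *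
      (\<Prod>j<length S. pvar (VarT j) ^ (e j + f j)))"
proof -
  note I = ideal_ideal_H[of S]
  have "H_cong S
      (gamma1 (S ! j) ^ e j * (pvar (varA (S ! j)) ^ e j * (gamma1 (S ! j) * pvar (varB (S ! j))) ^ f j))
      (gamma1 (S ! j) ^ e j * (pvar (VarT j) ^ e j * (gamma2 (S ! j) * pvar (VarT j)) ^ f j))"
    if "j < length S" for j
    by (rule icong_mult[OF I icong_refl[OF I mpoly_power_closed[OF gamma_closed(1)]]
          icong_mult[OF I icong_power[OF I H_cong_gens(1)[OF that]]
            icong_power[OF I H_cong_gens(2)[OF that]]]]) simp
  then have "H_cong S
      (\<Prod>j<length S. gamma1 (S ! j) ^ e j * (pvar (varA (S ! j)) ^ e j * (gamma1 (S ! j) * pvar (varB (S ! j))) ^ f j))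
      (\<Prod>j<length S. gamma1 (S ! j) ^ e j * (pvar (VarT j) ^ e j * (gamma2 (S ! j) * pvar (VarT j)) ^ f j))"
    by (intro icong_prod[OF I]) simp
  then show ?thesis
    by (simp add: gamma1_eq gamma2_eq power_mult_distrib power_add power_sum prod.distrib mult_ac
        flip: power_mult)
qed

lemma sibirsky_ideal_subset_elim_ideal:
  "sibirsky_ideal S \<subseteq> (elim_ideal S :: (sib_var, 'k::comm_ring_1) mpoly set)"
proof -
  let ?n = "length S"
  note I = ideal_ideal_H[of S, where 'a = 'k]
  have binomial: "sib_monom S \<nu> - sib_monom S (rev \<nu>) \<in> (ideal_H S :: (sib_var, 'k) mpoly set)"
    if \<nu>: "\<nu> \<in> sib_monoid S" for \<nu>
  proof -
    define e f where "e = (\<lambda>j. \<nu> ! j)" and "f = (\<lambda>j. \<nu> ! (2 * ?n - Suc j))"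
    define M :: "(nat \<Rightarrow> nat) \<Rightarrow> (nat \<Rightarrow> nat) \<Rightarrow> (sib_var, 'k) mpoly" where
      "M = (\<lambda>e f. \<Prod>j<?n. pvar (varA (S ! j)) ^ e j * pvar (varB (S ! j)) ^ f j)"
    define E where "E = (\<lambda>e f. \<Sum>j<?n. nat (- dif (S ! j)) * e j + nat (dif (S ! j)) * f j)"
    define P :: "(sib_var, 'k) mpoly" where "P = (\<Prod>j<?n. gamma1 (S ! j) ^ (e j + f j))"
    define T :: "(sib_var, 'k) mpoly" where "T = (\<Prod>j<?n. pvar (VarT j) ^ (e j + f j))"
    have len: "length \<nu> = 2 * ?n"
      and bal: "(\<Sum>j<?n. dif (S ! j) * (int (e j) - int (f j))) = 0"
      using \<nu> by (simp_all add: sib_monoid_iff e_def f_def)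
    \<comment> \<open>The mirror image exchanges the exponents of a and b within each pair.\<close>
    have M: "sib_monom S \<nu> = M e f" "sib_monom S (rev \<nu>) = M f e"
      unfolding sib_monom_halves M_def e_def f_def
      using len by (auto simp: rev_nth intro!: prod.cong)
    \<comment> \<open>Positive minus negative part of p - q is p - q itself, so the two gamma
      exponents differ by exactly the sum that vanishes on \<open>sib_monoid S\<close>.\<close>
    have "int (E f e) - int (E e f) = (\<Sum>j<?n. dif (S ! j) * (int (e j) - int (f j)))"
      unfolding E_def of_nat_sum sum_subtractf[symmetric]
    proof (rule sum.cong)
      fix j
      have "int (nat (dif (S ! j))) = dif (S ! j) + int (nat (- dif (S ! j)))"
        by simp
      then show "int (nat (- dif (S ! j)) * f j + nat (dif (S ! j)) * e j) -
          int (nat (- dif (S ! j)) * e j + nat (dif (S ! j)) * f j) =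
          dif (S ! j) * (int (e j) - int (f j))"
        by (simp only: of_nat_add of_nat_mult) (simp add: algebra_simps)
    qed simp
    then have "E f e = E e f" using bal by simp
    then have "H_cong S (P * M e f) (pvar VarGamma ^ E e f * T)"
      "H_cong S (P * M f e) (pvar VarGamma ^ E e f * T)"
      using H_cong_normal_form[of S e f] H_cong_normal_form[of S f e]
      unfolding P_def M_def E_def T_def by (simp_all add: add.commute)
    then have "H_cong S (P * M e f) (P * M f e)"
      using icong_sym[OF I] icong_trans[OF I] by blast
    moreover have "iunit (H_vars S) (ideal_H S) P"
      unfolding P_def by (intro iunit_prod[OF I] iunit_power[OF I] iunit_gamma1) simp
    moreover have "M e f \<in> carrier (ring_abtgw S)" for e f
      unfolding M_def using ab_vars_mem by (intro H_closed) auto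
    ultimately have "H_cong S (M e f) (M f e)"
      using iunit_cancel[OF I] by blast
    then show ?thesis unfolding M icong_def[OF I] by blast
  qed
  \<comment> \<open>Since the elimination ideal is an ideal of k[a,b], containing the binomial
    generators is enough.\<close>
  have "ideal (carrier (ring_ab S) \<inter> ideal_H S) (ring_ab S :: (sib_var, 'k) mpoly ring)"
    by (rule mpoly_ideal_contraction[OF I]) blast
  then show ?thesis
    unfolding sibirsky_ideal_def elim_ideal_def
    by (rule ring.genideal_minimal[OF cring.axioms(1)[OF mpoly_ring_cring]])
      (use binomial sib_gens_closed in blast)
qed

section \<open>The kernel of the parametrisation lies in the Sibirsky ideal\<close>

lemma lookup_toric_exp:
  assumes "Poly_Mapping.keys m \<subseteq> set (ab_list S)"
  shows "Poly_Mapping.lookup (toric_exp S m) 0 =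
      (\<Sum>x\<in>set S. int (Poly_Mapping.lookup m (varB x)) * dif x)"
    and "x \<in> set S \<Longrightarrow> Poly_Mapping.lookup (toric_exp S m) (Suc (to_nat x)) =
      int (Poly_Mapping.lookup m (varA x)) + int (Poly_Mapping.lookup m (varB x))"
proof -
  \<comment> \<open>Coordinate 0 is the gamma-degree, to which only b contributes; the other
    coordinates are t-degrees, to which a and b of a pair contribute equally.\<close>
  have weights: "Poly_Mapping.lookup (toric_weight S (varA y)) 0 = 0"
    "Poly_Mapping.lookup (toric_weight S (varB y)) 0 = dif y"
    "Poly_Mapping.lookup (toric_weight S (varA y)) (Suc (to_nat x)) = (if y = x then 1 else 0)"
    "Poly_Mapping.lookup (toric_weight S (varB y)) (Suc (to_nat x)) = (if y = x then 1 else 0)" for x y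
    by (cases y; cases x; simp add: toric_weight_def lookup_add lookup_single when_def; fail)+
  have eq: "Poly_Mapping.lookup (toric_exp S m) k =
      (\<Sum>x\<in>set S. int (Poly_Mapping.lookup m (varA x)) * Poly_Mapping.lookup (toric_weight S (varA x)) k +
        int (Poly_Mapping.lookup m (varB x)) * Poly_Mapping.lookup (toric_weight S (varB x)) k)" for k
    by (subst toric_exp_superset[OF _ assms]) (simp_all add: lookup_sum lookup_add sum_ab_list)
  show "Poly_Mapping.lookup (toric_exp S m) 0 =
      (\<Sum>x\<in>set S. int (Poly_Mapping.lookup m (varB x)) * dif x)"
    by (simp only: eq weights) simp
  show "Poly_Mapping.lookup (toric_exp S m) (Suc (to_nat x)) =
      int (Poly_Mapping.lookup m (varA x)) + int (Poly_Mapping.lookup m (varB x))" if "x \<in> set S"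
    using that by (simp only: eq weights) (simp add: sum.distrib if_distrib[of "(*) _"] cong: if_cong)
qed

lemma sum_nth_distinct:
  "distinct S \<Longrightarrow> (\<Sum>j<length S. f (S ! j)) = (\<Sum>x\<in>set S. f x)"
  by (rule sum.reindex_bij_betw[OF bij_betw_nth]) auto

(* After the common factor min(m, n) is split off, the two remaining exponents have disjoint
   supports, and equality of the t-degrees forces them to be exchanged by swap_ab. *)
lemma toric_binomial_in_sibirsky_ideal:
  fixes c :: "'k::comm_ring_1"
  assumes S: "distinct S"
    and m: "Poly_Mapping.keys m \<subseteq> set (ab_list S)" and n: "Poly_Mapping.keys n \<subseteq> set (ab_list S)"
    and eq: "toric_exp S m = toric_exp S n"
  shows "Poly_Mapping.single m c - Poly_Mapping.single n c \<in> sibirsky_ideal S"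
proof -
  let ?L = "ab_list S" and ?l = "Poly_Mapping.lookup"
  \<comment> \<open>Subtraction of natural numbers truncates at 0, so \<theta> is the pointwise
    minimum of \<open>m\<close> and \<open>n\<close>.\<close>
  define \<alpha> \<beta> \<theta> where "\<alpha> = m - n" and "\<beta> = n - m" and "\<theta> = m - (m - n)"
  have lookups: "?l \<alpha> v = ?l m v - ?l n v" "?l \<beta> v = ?l n v - ?l m v"
    "?l \<theta> v = ?l m v - (?l m v - ?l n v)" for v
    by (simp_all add: \<alpha>_def \<beta>_def \<theta>_def lookup_minus)
  have mn: "m = \<theta> + \<alpha>" "n = \<theta> + \<beta>"
    by (rule poly_mapping_eqI, simp add: lookup_add lookups)+
  have keys: "Poly_Mapping.keys \<alpha> \<subseteq> set ?L" "Poly_Mapping.keys \<beta> \<subseteq> set ?L"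
    "Poly_Mapping.keys \<theta> \<subseteq> set ?L"
    using m n by (auto simp: in_keys_iff lookups subset_iff)
  have "toric_exp S \<alpha> = toric_exp S \<beta>"
    using eq by (simp add: mn toric_exp_add)
  note exps = arg_cong[OF this, of "\<lambda>f. ?l f k" for k]
  have deg: "?l \<alpha> (varA x) + ?l \<alpha> (varB x) = ?l \<beta> (varA x) + ?l \<beta> (varB x)" if "x \<in> set S" for x
    using exps[of "Suc (to_nat x)"] that by (simp add: lookup_toric_exp keys)
  \<comment> \<open>At each variable \<alpha> or \<beta> is 0. If \<alpha> were positive at both
    variables of a pair, \<beta> would vanish at both, against \<open>deg\<close>; the same holds
    with the roles exchanged.\<close>
  have swapped: "?l \<alpha> (varB x) = ?l \<beta> (varA x)" "?l \<alpha> (varA x) = ?l \<beta> (varB x)" if "x \<in> set S" for x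
    using deg[OF that] unfolding lookups by linarith+
  define \<nu> where "\<nu> = map (?l \<alpha>) ?L"
  have "rev \<nu> = map (?l \<alpha>) (map swap_ab ?L)"
    by (simp add: \<nu>_def rev_map rev_ab_list)
  also have "\<dots> = map (?l \<beta>) ?L"
    using swapped by (auto simp: set_ab_list swap_ab_def)
  finally have rev: "rev \<nu> = map (?l \<beta>) ?L" .
  have "(\<Sum>j<length S. dif (S ! j) * (int (\<nu> ! j) - int (\<nu> ! (2 * length S - Suc j)))) =
      (\<Sum>j<length S. dif (S ! j) * (int (?l \<alpha> (varA (S ! j))) - int (?l \<alpha> (varB (S ! j)))))"
    by (rule sum.cong) (simp_all add: \<nu>_def ab_list_nth)
  also have "\<dots> = (\<Sum>x\<in>set S. dif x * (int (?l \<alpha> (varA x)) - int (?l \<alpha> (varB x))))"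
    by (rule sum_nth_distinct[OF S])
  \<comment> \<open>Replacing the a exponent of \<alpha> by the b exponent of \<beta> turns the
    balance into a difference of gamma-degrees, which are equal.\<close>
  also have "\<dots> = ?l (toric_exp S \<beta>) 0 - ?l (toric_exp S \<alpha>) 0"
    by (simp add: lookup_toric_exp keys swapped sum_subtractf right_diff_distrib mult.commute)
  finally have "\<nu> \<in> sib_monoid S"
    using exps[of 0] by (simp add: sib_monoid_iff \<nu>_def)
  then have "sib_monom S \<nu> - sib_monom S (rev \<nu>) \<in> (sibirsky_ideal S :: (sib_var, 'k) mpoly set)"
    by (rule sib_gens_subset)
  then have "Poly_Mapping.single \<alpha> 1 - Poly_Mapping.single \<beta> 1 \<in> (sibirsky_ideal S :: (sib_var, 'k) mpoly set)"
    by (simp only: rev) (simp add: \<nu>_def sib_monom_eq_single[OF S] keys)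
  moreover have "Poly_Mapping.single \<theta> c \<in> carrier (ring_ab S)"
    using keys by (simp add: mpoly_carrier_iff)
  ultimately have "Poly_Mapping.single \<theta> c * (Poly_Mapping.single \<alpha> 1 - Poly_Mapping.single \<beta> 1)
      \<in> sibirsky_ideal S"
    by (rule mpoly_ideal_mult[OF ideal_sibirsky_ideal])
  then show ?thesis
    by (simp add: mn right_diff_distrib mult_single)
qed

(* If r picks an exponent in each fibre of toric_exp S, then f is congruent modulo the binomials
   to push r (toric S f), which vanishes together with toric S f. *)
lemma toric_kernel_subset_sibirsky_ideal:
  assumes S: "distinct S" and f: "f \<in> carrier (ring_ab S)" and 0: "toric S f = 0"
  shows "f \<in> sibirsky_ideal S"
proof -
  \<comment> \<open>Choosing among the keys of \<open>f\<close> keeps the representative an exponent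
    in the variables a and b.\<close>
  define r where "r = (\<lambda>u. SOME m. m \<in> Poly_Mapping.keys f \<and> toric_exp S m = u)"
  have r: "r (toric_exp S m) \<in> Poly_Mapping.keys f" "toric_exp S (r (toric_exp S m)) = toric_exp S m"
    if "m \<in> Poly_Mapping.keys f" for m
    using someI[of "\<lambda>n. n \<in> Poly_Mapping.keys f \<and> toric_exp S n = toric_exp S m" m] that
    by (auto simp: r_def)
  have "f = f - push r (toric S f)" by (simp add: 0)
  also have "\<dots> = (\<Sum>m\<in>Poly_Mapping.keys f. Poly_Mapping.single m (Poly_Mapping.lookup f m) -
      Poly_Mapping.single (r (toric_exp S m)) (Poly_Mapping.lookup f m))"
    by (simp add: push_push sum_subtractf poly_mapping_expansion)
  also have "\<dots> \<in> sibirsky_ideal S"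
    using f r by (intro mpoly_ideal_sum[OF ideal_sibirsky_ideal] toric_binomial_in_sibirsky_ideal S)
      (auto simp: mpoly_carrier_iff)
  finally show ?thesis .
qed

theorem mainTheorem3:
  fixes S :: "(int \<times> nat) list"
  assumes "infinite (UNIV :: 'k::field set)"
    and "distinct S"
    and "\<forall>(p, q) \<in> set S. p \<ge> -1 \<and> p + int q \<ge> 0"
  shows "(sibirsky_ideal S :: (sib_var, 'k) mpoly set) = elim_ideal S
    \<and> primeideal (sibirsky_ideal S :: (sib_var, 'k) mpoly set) (ring_ab S)
    \<and> primeideal (elim_ideal S :: (sib_var, 'k) mpoly set) (ring_ab S)"
proof -
  let ?J = "{f \<in> carrier (ring_ab S). toric S f = (0 :: _ \<Rightarrow>\<^sub>0 'k)}"
  \<comment> \<open>Restricting the inclusion of H in the kernel from all variables to k[a,b] opens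
    the cycle of inclusions.\<close>
  have "elim_ideal S \<subseteq> ?J"
    using ideal_H_subset_kernel[of S, where 'k = 'k] by (auto simp: elim_ideal_def)
  moreover have "?J \<subseteq> sibirsky_ideal S"
    using toric_kernel_subset_sibirsky_ideal[OF assms(2)] by blast
  moreover note sibirsky_ideal_subset_elim_ideal[of S, where 'k = 'k]
  ultimately have "sibirsky_ideal S = ?J" "elim_ideal S = ?J" by blast+
  then show ?thesis using toric_kernel_primeideal by simp
qed

end
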